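(* Let $p$ be a prime and let $A$ be a skew left brace of size $p^m$ (for some non-negative integer $m$). Then $A$ is left nilpotent.
   Context: A skew left brace is a triple $(A,+,\circ)$ where $(A,+)$ and $(A,\circ)$ are (not necessarily abelian) groups such that $a\circ(b+c)=a\circ b-a+a\circ c$ for all $a,b,c\in A$. The two groups share the same neutral element $0$. For $a,b\in A$ put $a*b=-a+a\circ b-b$. For subsets $X,Y\subseteq A$, $X*Y$ denotes the subgroup of $(A,+)$ generated by all $x*y$ with $x\in X$, $y\in Y$. The left series of $A$ is $A^1=A$, $A^{n+1}=A*A^n$ for $n\ge 1$; $A$ is left nilpotent if $A^k=0$ for some $k\ge 1$. *)

theory Defs
  imports "HOL-Algebra.Generated_Groups" "HOL-Algebra.Ring" "HOL-Algebra.Sylow"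
begin

text \<open>
  A skew left brace \<open>(A, +, \<circ>)\<close> is carried by the record type of rings: \<open>\<oplus>\<close> is the additive
  operation, \<open>\<otimes>\<close> is the circle operation, \<open>\<zero>\<close> and \<open>\<one>\<close> are the two neutral elements (which
  necessarily coincide). No ring axiom is assumed, and neither group need be abelian; in
  particular \<open>a \<ominus> b\<close> means \<open>a \<oplus> (\<ominus> b)\<close>, in this order.
\<close>

locale skew_left_brace =
  fixes A :: "('a, 'b) ring_scheme" (structure)
  assumes add_group: "group (add_monoid A)"
    and circ_group: "group A"
    and circ_add:
      "\<lbrakk>a \<in> carrier A; b \<in> carrier A; c \<in> carrier A\<rbrakk>
        \<Longrightarrow> a \<otimes> (b \<oplus> c) = a \<otimes> b \<ominus> a \<oplus> a \<otimes> c"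

definition brace_star :: "('a, 'b) ring_scheme \<Rightarrow> 'a \<Rightarrow> 'a \<Rightarrow> 'a"
  where "brace_star A a b = \<ominus>\<^bsub>A\<^esub> a \<oplus>\<^bsub>A\<^esub> a \<otimes>\<^bsub>A\<^esub> b \<ominus>\<^bsub>A\<^esub> b"

definition set_star :: "('a, 'b) ring_scheme \<Rightarrow> 'a set \<Rightarrow> 'a set \<Rightarrow> 'a set"
  where "set_star A X Y = generate (add_monoid A) {brace_star A x y | x y. x \<in> X \<and> y \<in> Y}"

text \<open>The left series is indexed from 1; the value at 0 is a dummy and never used.\<close>

fun left_series :: "('a, 'b) ring_scheme \<Rightarrow> nat \<Rightarrow> 'a set"
  where
    "left_series A 0 = carrier A"
  | "left_series A (Suc 0) = carrier A"
  | "left_series A (Suc (Suc n)) = set_star A (carrier A) (left_series A (Suc n))"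

definition left_nilpotent :: "('a, 'b) ring_scheme \<Rightarrow> bool"
  where "left_nilpotent A \<longleftrightarrow> (\<exists>k\<ge>1. left_series A k = {\<zero>\<^bsub>A\<^esub>})"

end

theory Submission
  imports Defs "HOL-Algebra.Group_Action"
begin

text \<open>
  The circle group acts on the additive group by the automorphisms
  \<open>\<lambda>\<^sub>a(b) = - a + a \<circ> b\<close>, and \<open>a * b = \<lambda>\<^sub>a(b) - b\<close>. Each term \<open>S\<close> of the left series is an
  invariant subgroup; let \<open>N\<close> be a maximal invariant proper subgroup of \<open>S \<noteq> 0\<close>. Counting fixed
  points modulo \<open>p\<close>, first for \<open>N\<close> acting on the right cosets of \<open>N\<close> in \<open>S\<close> by translation and then
  for the circle group acting on the fixed cosets, gives a coset \<open>N + x \<noteq> N\<close> fixed by both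
  actions. The elements of all such cosets form an invariant subgroup larger than \<open>N\<close>, hence equal
  to \<open>S\<close>. So \<open>A * S \<subseteq> N\<close>, and the left series strictly decreases until it reaches \<open>0\<close>.
\<close>

section \<open>Fixed points of actions of groups of prime power order\<close>

text \<open>Bridges plain functions and \<open>group_action\<close>: elements of
  \<open>BijGroup E\<close> are extensional, hence the \<open>restrict\<close>. Each \<phi> g is
  bijective on \<open>E\<close> because \<phi> of the inverse of \<open>g\<close> undoes it.\<close>

lemma group_actionI:
  assumes G: "group G"
    and closed: "\<And>g x. \<lbrakk>g \<in> carrier G; x \<in> E\<rbrakk> \<Longrightarrow> \<phi> g x \<in> E"
    and one: "\<And>x. x \<in> E \<Longrightarrow> \<phi> \<one>\<^bsub>G\<^esub> x = x"
    and mult: "\<And>g h x. \<lbrakk>g \<in> carrier G; h \<in> carrier G; x \<in> E\<rbrakk>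
      \<Longrightarrow> \<phi> (g \<otimes>\<^bsub>G\<^esub> h) x = \<phi> g (\<phi> h x)"
  shows "group_action G E (\<lambda>g. restrict (\<phi> g) E)"
proof -
  interpret group G by (rule G)
  have bij: "restrict (\<phi> g) E \<in> Bij E" if g: "g \<in> carrier G" for g
  proof -
    have "bij_betw (\<phi> g) E E"
    proof (rule bij_betwI[where g = "\<phi> (inv\<^bsub>G\<^esub> g)"])
      show "\<phi> (inv\<^bsub>G\<^esub> g) (\<phi> g x) = x" if "x \<in> E" for x
        using mult[of "inv\<^bsub>G\<^esub> g" g x] one g that by simp
      show "\<phi> g (\<phi> (inv\<^bsub>G\<^esub> g) x) = x" if "x \<in> E" for x
        using mult[of g "inv\<^bsub>G\<^esub> g" x] one g that by simp
    qed (use closed g in auto)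
    thus ?thesis by (simp add: Bij_def bij_betw_restrict_eq)
  qed
  have "(\<lambda>g. restrict (\<phi> g) E) \<in> hom G (BijGroup E)"
  proof (rule homI)
    show "restrict (\<phi> g) E \<in> carrier (BijGroup E)" if "g \<in> carrier G" for g
      using bij that by (simp add: BijGroup_def)
    show "restrict (\<phi> (g \<otimes>\<^bsub>G\<^esub> h)) E = restrict (\<phi> g) E \<otimes>\<^bsub>BijGroup E\<^esub> restrict (\<phi> h) E"
      if "g \<in> carrier G" "h \<in> carrier G" for g h
      using bij that mult closed by (auto simp: BijGroup_def compose_def fun_eq_iff)
  qed
  thus ?thesis
    by (intro group_action.intro group_hom.intro group_hom_axioms.intro group_BijGroup G)
qed

text \<open>By orbit-stabilizer every orbit has \<open>p\<close>-power size, so an orbit is either a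
  single fixed point or has size divisible by \<open>p\<close>. Hence \<open>card E\<close> and the
  number of fixed points agree modulo \<open>p\<close>.\<close>

lemma prime_dvd_card_fixed_points:
  assumes G: "group G" and p: "Factorial_Ring.prime p" and ord: "order G = p ^ k"
    and closed: "\<And>g x. \<lbrakk>g \<in> carrier G; x \<in> E\<rbrakk> \<Longrightarrow> \<phi> g x \<in> E"
    and one: "\<And>x. x \<in> E \<Longrightarrow> \<phi> \<one>\<^bsub>G\<^esub> x = x"
    and mult: "\<And>g h x. \<lbrakk>g \<in> carrier G; h \<in> carrier G; x \<in> E\<rbrakk>
      \<Longrightarrow> \<phi> (g \<otimes>\<^bsub>G\<^esub> h) x = \<phi> g (\<phi> h x)"
    and fin: "finite E" and dvd: "p dvd card E"
  shows "p dvd card {x \<in> E. \<forall>g\<in>carrier G. \<phi> g x = x}"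
proof -
  define \<psi> where "\<psi> = (\<lambda>g. restrict (\<phi> g) E)"
  interpret A: group_action G E \<psi>
    unfolding \<psi>_def by (rule group_actionI) (use assms in auto)
  define F where "F = {x \<in> E. \<forall>g\<in>carrier G. \<phi> g x = x}"
  \<comment> \<open>The indicator of the non-fixed points: summing it orbit by orbit counts
    \<open>E - F\<close>, and each orbit contributes a multiple of \<open>p\<close>.\<close>
  define f where "f = (\<lambda>x. if x \<in> F then 0 else 1 :: nat)"
  have orbit_eq: "orbit G \<psi> x = {\<phi> g x | g. g \<in> carrier G}" if "x \<in> E" for x
    using that by (simp add: orbit_def \<psi>_def)
  have "p dvd (\<Sum>x\<in>orb. f x)" if orb: "orb \<in> orbits G E \<psi>" for orb
  proof -
    obtain x where x: "x \<in> E" "orb = orbit G \<psi> x"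
      using orb by (auto simp: orbits_def)
    have x_orb: "x \<in> orb" using A.orbit_refl x by simp
    have sub: "orb \<subseteq> E" using x closed orbit_eq by auto
    show ?thesis
    proof (cases "orb \<inter> F = {}")
      case True
      have "x \<notin> F" using True x_orb by auto
      then obtain g where "g \<in> carrier G" "\<phi> g x \<noteq> x" using x by (auto simp: F_def)
      hence "{x, \<phi> g x} \<subseteq> orb" "card {x, \<phi> g x} = 2"
        using x_orb x orbit_eq by auto
      moreover have "finite orb" using fin sub finite_subset by auto
      ultimately have "card orb \<noteq> 1"
        using card_mono[of orb "{x, \<phi> g x}"] by linarith
      moreover have "card orb dvd p ^ k"
        using A.orbit_stabilizer_theorem[OF x(1)] x(2) ord by (metis dvd_triv_left)
      ultimately have "p dvd card orb"
        using p by (metis divides_primepow_nat dvd_power neq0_conv power_0)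
      moreover have "(\<Sum>x\<in>orb. f x) = card orb"
        using True by (simp add: f_def disjoint_iff)
      ultimately show ?thesis by simp
    next
      case False
      then obtain y where y: "y \<in> orb" "y \<in> F" by auto
      \<comment> \<open>The orbit of the fixed point \<open>y\<close> is just \<open>{y}\<close>, so
        an orbit that meets \<open>F\<close> is a singleton and contributes 0.\<close>
      have "x \<in> orbit G \<psi> y"
        using A.orbit_sym[of x y] x y sub by auto
      hence "x = y" using y orbit_eq by (auto simp: F_def)
      hence "orb = {x}" using x y orbit_eq x_orb by (auto simp: F_def)
      thus ?thesis using \<open>x = y\<close> y by (simp add: f_def)
    qed
  qed
  hence "p dvd (\<Sum>orb\<in>orbits G E \<psi>. \<Sum>x\<in>orb. f x)" by (rule dvd_sum)
  hence "p dvd (\<Sum>x\<in>E. f x)" using A.disjoint_sum[OF fin] by metis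
  also have "(\<Sum>x\<in>E. f x) = (\<Sum>x\<in>E - F. 1)"
    unfolding f_def using fin by (intro sum.mono_neutral_cong_right) auto
  also have "\<dots> = card (E - F)" by simp
  finally have "p dvd card (E - F)" .
  moreover have "card E = card (E - F) + card F"
    using fin by (metis (no_types, lifting) F_def add.commute card_Diff_subset card_mono
        finite_subset le_add_diff_inverse mem_Collect_eq subsetI)
  ultimately show ?thesis using dvd unfolding F_def[symmetric]
    by (metis dvd_add_right_iff)
qed

lemma (in group) inv_mult_cancel_left:
  assumes "x \<in> carrier G" "y \<in> carrier G"
  shows "inv x \<otimes> (x \<otimes> y) = y" and "x \<otimes> (inv x \<otimes> y) = y"
  using assms by (simp_all add: m_assoc[symmetric])

section \<open>Actions by automorphisms\<close>

text \<open>Only endomorphisms are demanded; they are automorphisms because \<open>h\<close> and its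
  inverse act as mutually inverse maps.\<close>

locale automorphism_action = G: group G + H: group H
  for G :: "('a, 'b) monoid_scheme" (structure) and H :: "('c, 'd) monoid_scheme" +
  fixes \<phi> :: "'c \<Rightarrow> 'a \<Rightarrow> 'a"
  assumes act_hom: "h \<in> carrier H \<Longrightarrow> \<phi> h \<in> hom G G"
    and act_one: "x \<in> carrier G \<Longrightarrow> \<phi> \<one>\<^bsub>H\<^esub> x = x"
    and act_mult: "\<lbrakk>h \<in> carrier H; k \<in> carrier H; x \<in> carrier G\<rbrakk>
      \<Longrightarrow> \<phi> (h \<otimes>\<^bsub>H\<^esub> k) x = \<phi> h (\<phi> k x)"
begin

lemma act_closed: "\<lbrakk>h \<in> carrier H; x \<in> carrier G\<rbrakk> \<Longrightarrow> \<phi> h x \<in> carrier G"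
  using act_hom by (auto simp: hom_def)

lemma act_m: "\<lbrakk>h \<in> carrier H; x \<in> carrier G; y \<in> carrier G\<rbrakk> \<Longrightarrow> \<phi> h (x \<otimes> y) = \<phi> h x \<otimes> \<phi> h y"
  using act_hom by (auto simp: hom_def)

lemma act_group_hom: "h \<in> carrier H \<Longrightarrow> group_hom G G (\<phi> h)"
  using act_hom by (intro group_hom.intro group_hom_axioms.intro G.is_group)

lemma act_G_one: "h \<in> carrier H \<Longrightarrow> \<phi> h \<one> = \<one>"
  by (rule group_hom.hom_one[OF act_group_hom])

lemma act_inv: "\<lbrakk>h \<in> carrier H; x \<in> carrier G\<rbrakk> \<Longrightarrow> \<phi> h (inv x) = inv (\<phi> h x)"
  by (rule group_hom.hom_inv[OF act_group_hom])

section \<open>Invariant subgroups and their right cosets\<close>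

definition invariant_subgroup :: "'a set \<Rightarrow> bool"
  where "invariant_subgroup S \<longleftrightarrow> subgroup S G \<and> (\<forall>h\<in>carrier H. \<forall>x\<in>S. \<phi> h x \<in> S)"

text \<open>Allows the results on \<open>G\<close> to be applied to a term of the left series as a
  group in its own right.\<close>

lemma automorphism_action_subgroup:
  assumes "invariant_subgroup S"
  shows "automorphism_action (G\<lparr>carrier := S\<rparr>) H \<phi>"
proof -
  have S: "subgroup S G" using assms by (simp add: invariant_subgroup_def)
  interpret S: group "G\<lparr>carrier := S\<rparr>" using S by (rule G.subgroup_imp_group)
  show ?thesis
    by unfold_locales
      (use assms subgroup.mem_carrier[OF S] act_m act_one act_mult in
        \<open>auto simp: hom_def invariant_subgroup_def\<close>)
qed

lemma invariant_subgroup_image: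
  assumes N: "invariant_subgroup N" and h: "h \<in> carrier H"
  shows "\<phi> h ` N = N"
proof
  show "\<phi> h ` N \<subseteq> N" using assms by (auto simp: invariant_subgroup_def)
  show "N \<subseteq> \<phi> h ` N"
  proof
    fix x assume x: "x \<in> N"
    hence "x \<in> carrier G" using N subgroup.mem_carrier by (auto simp: invariant_subgroup_def)
    hence "x = \<phi> h (\<phi> (inv\<^bsub>H\<^esub> h) x)"
      using act_mult[of h "inv\<^bsub>H\<^esub> h" x] h act_one by simp
    moreover have "\<phi> (inv\<^bsub>H\<^esub> h) x \<in> N" using x N h by (auto simp: invariant_subgroup_def)
    ultimately show "x \<in> \<phi> h ` N" by blast
  qed
qed

lemma image_r_coset:
  assumes N: "invariant_subgroup N" and h: "h \<in> carrier H" and x: "x \<in> carrier G"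
  shows "\<phi> h ` (N #> x) = N #> \<phi> h x"
proof -
  have "N \<subseteq> carrier G" using N subgroup.subset by (auto simp: invariant_subgroup_def)
  hence "(\<lambda>n. \<phi> h (n \<otimes> x)) ` N = (\<lambda>n. \<phi> h n \<otimes> \<phi> h x) ` N"
    using act_m h x by (intro image_cong) auto
  hence "\<phi> h ` (N #> x) = (\<phi> h ` N) #> \<phi> h x"
    by (simp add: r_coset_def UNION_singleton_eq_range image_image)
  thus ?thesis by (simp add: invariant_subgroup_image[OF N h])
qed

text \<open>The two clauses say that the coset \<open>N #> x\<close> is fixed by right translation
  by \<open>N\<close> and by \<open>H\<close>. For finite \<open>N\<close> the first clause defines
  the normalizer of \<open>N\<close>, so this is the preimage of the \<open>H\<close>-fixed points
  of the normalizer modulo \<open>N\<close>.\<close>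

definition fixed_coset_elements :: "'a set \<Rightarrow> 'a set"
  where "fixed_coset_elements N = {x \<in> carrier G.
    (\<forall>n\<in>N. x \<otimes> n \<otimes> inv x \<in> N) \<and> (\<forall>h\<in>carrier H. \<phi> h x \<otimes> inv x \<in> N)}"

lemma fixed_coset_elements_invariant:
  assumes N: "invariant_subgroup N" and fin: "finite (carrier G)"
  shows "invariant_subgroup (fixed_coset_elements N)" (is "invariant_subgroup ?T")
    and "N \<subseteq> fixed_coset_elements N"
proof -
  interpret N: subgroup N G using N by (simp add: invariant_subgroup_def)
  have Ninv: "\<And>h n. \<lbrakk>h \<in> carrier H; n \<in> N\<rbrakk> \<Longrightarrow> \<phi> h n \<in> N"
    using N by (simp add: invariant_subgroup_def)
  show sub: "N \<subseteq> ?T"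
    using Ninv by (auto simp: fixed_coset_elements_def)
  have mult: "x \<otimes> y \<in> ?T" if x: "x \<in> ?T" and y: "y \<in> ?T" for x y
  proof -
    have c: "x \<in> carrier G" "y \<in> carrier G" using x y by (auto simp: fixed_coset_elements_def)
    have "x \<otimes> y \<otimes> n \<otimes> inv (x \<otimes> y) \<in> N" if "n \<in> N" for n
    proof -
      have "x \<otimes> (y \<otimes> n \<otimes> inv y) \<otimes> inv x \<in> N"
        using x y that by (auto simp: fixed_coset_elements_def)
      thus ?thesis using c that by (simp add: G.inv_mult_group G.m_assoc)
    qed
    moreover have "\<phi> h (x \<otimes> y) \<otimes> inv (x \<otimes> y) \<in> N" if h: "h \<in> carrier H" for h
    proof -
      \<comment> \<open>The second factor is an element of \<open>N\<close> conjugated by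
        \<open>x\<close>, hence in \<open>N\<close>; the product telescopes.\<close>
      have "(\<phi> h x \<otimes> inv x) \<otimes> (x \<otimes> (\<phi> h y \<otimes> inv y) \<otimes> inv x) \<in> N"
        using x y h by (auto simp: fixed_coset_elements_def)
      also have "(\<phi> h x \<otimes> inv x) \<otimes> (x \<otimes> (\<phi> h y \<otimes> inv y) \<otimes> inv x)
          = \<phi> h (x \<otimes> y) \<otimes> inv (x \<otimes> y)"
        using c h act_closed
        by (simp add: G.inv_mult_group G.m_assoc G.inv_mult_cancel_left act_m)
      finally show ?thesis .
    qed
    ultimately show ?thesis using c by (simp add: fixed_coset_elements_def)
  qed
  have inv: "inv x \<in> ?T" if x: "x \<in> ?T" for x
  proof -
    have c: "x \<in> carrier G" using x by (auto simp: fixed_coset_elements_def)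
    \<comment> \<open>Finiteness enters here: conjugation by \<open>x\<close> is an injective
      self-map of \<open>N\<close>, hence onto, so conjugation by \<open>inv x\<close> preserves
      \<open>N\<close> as well.\<close>
    have "(\<lambda>n. x \<otimes> n \<otimes> inv x) ` N = N"
    proof (rule endo_inj_surj)
      show "finite N" using fin N.subset finite_subset by blast
      show "(\<lambda>n. x \<otimes> n \<otimes> inv x) ` N \<subseteq> N" using x by (auto simp: fixed_coset_elements_def)
      show "inj_on (\<lambda>n. x \<otimes> n \<otimes> inv x) N" using c by (auto simp: inj_on_def)
    qed
    have conj: "inv x \<otimes> n \<otimes> x \<in> N" if "n \<in> N" for n
    proof -
      obtain m where m: "m \<in> N" "n = x \<otimes> m \<otimes> inv x"
        using \<open>_ ` N = N\<close> \<open>n \<in> N\<close> by blast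
      thus ?thesis using c by (simp add: G.m_assoc G.inv_mult_cancel_left)
    qed
    moreover have "\<phi> h (inv x) \<otimes> x \<in> N" if h: "h \<in> carrier H" for h
    proof -
      have "inv (\<phi> h x \<otimes> inv x) \<in> N" using x h by (auto simp: fixed_coset_elements_def)
      hence "inv x \<otimes> (x \<otimes> inv (\<phi> h x)) \<otimes> x \<in> N"
        using conj c h act_closed by (simp add: G.inv_mult_group)
      also have "inv x \<otimes> (x \<otimes> inv (\<phi> h x)) \<otimes> x = \<phi> h (inv x) \<otimes> x"
        using c h act_closed by (simp add: G.m_assoc[symmetric] act_inv)
      finally show ?thesis .
    qed
    ultimately show ?thesis using c by (simp add: fixed_coset_elements_def)
  qed
  have "subgroup ?T G"
    by (rule subgroup.intro)
      (use mult inv sub N.one_closed in \<open>auto simp: fixed_coset_elements_def act_G_one\<close>)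
  moreover have "\<phi> h x \<in> ?T" if h: "h \<in> carrier H" and x: "x \<in> ?T" for h x
  proof -
    have c: "x \<in> carrier G" using x by (auto simp: fixed_coset_elements_def)
    have "\<phi> h x \<otimes> inv x \<in> ?T"
      using x h sub by (auto simp: fixed_coset_elements_def)
    hence "\<phi> h x \<otimes> inv x \<otimes> x \<in> ?T" using mult x by blast
    thus ?thesis using c h act_closed by (simp add: G.m_assoc)
  qed
  ultimately show "invariant_subgroup ?T" by (simp add: invariant_subgroup_def)
qed

text \<open>The index of \<open>N\<close> is a power of \<open>p\<close> other than 1, so
  \<open>p\<close> divides in turn the sizes of \<open>E\<close>, \<open>Y\<close> and
  \<open>Z\<close> below. Since \<open>N\<close> lies in \<open>Z\<close>, there is a second coset
  in \<open>Z\<close>, and its representatives lie outside \<open>N\<close>.\<close>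

lemma fixed_coset_elements_greater:
  assumes N: "invariant_subgroup N" and p: "Factorial_Ring.prime p"
    and ordG: "order G = p ^ m" and ordH: "order H = p ^ k"
    and proper: "N \<noteq> carrier G"
  shows "fixed_coset_elements N \<noteq> N"
proof -
  interpret N: subgroup N G using N by (simp add: invariant_subgroup_def)
  have sN: "subgroup N G" by (rule N.subgroup_axioms)
  have fin: "finite (carrier G)"
    using ordG p by (metis G.order_gt_0_iff_finite prime_gt_0_nat zero_less_power)
  have lag: "card (rcosets N) * card N = p ^ m"
    using G.lagrange[OF sN] ordG by simp
  define E where "E = rcosets N"
  have finE: "finite E" unfolding E_def using fin G.rcosets_subset_PowG[OF sN]
    by (meson finite_Pow_iff finite_subset)
  obtain j where j: "card N = p ^ j"
    using lag p by (metis divides_primepow_nat dvd_triv_right)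
  have "card E \<noteq> 1"
  proof
    assume "card E = 1"
    hence "card N = card (carrier G)" using lag ordG by (simp add: E_def order_def)
    thus False using proper card_subset_eq[OF fin N.subset] by simp
  qed
  moreover have "card E dvd p ^ m" using lag unfolding E_def by (metis dvd_triv_left)
  ultimately have pE: "p dvd card E"
    using p by (metis divides_primepow_nat dvd_power neq0_conv power_0)
  have Esub: "C \<subseteq> carrier G" if "C \<in> E" for C
    using that N.rcosets_carrier[OF G.is_group] by (simp add: E_def)
  \<comment> \<open>Translating by \<open>inv n\<close> turns right multiplication into a left
    action, as the fixed point lemma requires; the fixed cosets are the same.\<close>
  define Y where "Y = {C \<in> E. \<forall>n\<in>carrier (G\<lparr>carrier := N\<rparr>). C #> inv n = C}"
  have "p dvd card Y"
    unfolding Y_def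
  proof (rule prime_dvd_card_fixed_points[where k = j])
    show "group (G\<lparr>carrier := N\<rparr>)" using sN by (rule G.subgroup_imp_group)
    show "order (G\<lparr>carrier := N\<rparr>) = p ^ j" using j by (simp add: order_def)
    show "C #> inv n \<in> E" if "n \<in> carrier (G\<lparr>carrier := N\<rparr>)" "C \<in> E" for n C
      using that by (auto simp: E_def RCOSETS_def G.coset_mult_assoc N.subset)
    show "C #> inv \<one>\<^bsub>G\<lparr>carrier := N\<rparr>\<^esub> = C" if "C \<in> E" for C
      using Esub that by (simp add: G.coset_mult_one)
    show "C #> inv (n \<otimes>\<^bsub>G\<lparr>carrier := N\<rparr>\<^esub> n') = C #> inv n' #> inv n"
      if "n \<in> carrier (G\<lparr>carrier := N\<rparr>)" "n' \<in> carrier (G\<lparr>carrier := N\<rparr>)" "C \<in> E" for n n' C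
      using Esub that by (simp add: G.coset_mult_assoc G.inv_mult_group)
  qed (use p finE pE in auto)
  have Y_iff: "N #> x \<in> Y \<longleftrightarrow> (\<forall>n\<in>N. x \<otimes> n \<otimes> inv x \<in> N)" if x: "x \<in> carrier G" for x
  proof -
    have "N #> x #> n = N #> x \<longleftrightarrow> x \<otimes> n \<otimes> inv x \<in> N" if n: "n \<in> N" for n
    proof -
      have "N #> x #> n = N #> (x \<otimes> n)" using x n by (simp add: G.coset_mult_assoc N.subset)
      also have "\<dots> = N #> x \<longleftrightarrow> x \<otimes> n \<otimes> inv x \<in> N"
        using x n sN by (metis G.coset_join1 G.coset_join2 G.coset_mult_inv1 G.coset_mult_inv2
            G.inv_closed G.m_closed N.mem_carrier N.subset)
      finally show ?thesis .
    qed
    moreover have "N #> x \<in> E" using x by (simp add: E_def G.rcosetsI N.subset)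
    ultimately show ?thesis
      unfolding Y_def by simp (metis G.inv_inv N.m_inv_closed N.mem_carrier)
  qed
  have YE: "Y \<subseteq> E" by (auto simp: Y_def)
  hence Ysub: "\<And>C x. \<lbrakk>C \<in> Y; x \<in> C\<rbrakk> \<Longrightarrow> x \<in> carrier G" using Esub by blast
  define Z where "Z = {C \<in> Y. \<forall>h\<in>carrier H. \<phi> h ` C = C}"
  have "p dvd card Z"
    unfolding Z_def
  proof (rule prime_dvd_card_fixed_points[where k = k])
    show "\<phi> h ` C \<in> Y" if h: "h \<in> carrier H" and C: "C \<in> Y" for h C
    proof -
      obtain x where x: "x \<in> carrier G" "C = N #> x"
        using C YE unfolding E_def RCOSETS_def by blast
      \<comment> \<open>\<open>H\<close> must preserve \<open>Y\<close> to act on it. Writing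
        \<open>n\<close> as \<phi> h m with \<open>m\<close> in \<open>N\<close> exhibits this
        conjugate as the image under \<phi> h of a conjugate of \<open>m\<close> by
        \<open>x\<close>.\<close>
      have "\<phi> h x \<otimes> n \<otimes> inv (\<phi> h x) \<in> N" if "n \<in> N" for n
      proof -
        have "n \<in> \<phi> h ` N" using that invariant_subgroup_image[OF N h] by simp
        then obtain m where m: "m \<in> N" "n = \<phi> h m" by blast
        have "\<phi> h (x \<otimes> m \<otimes> inv x) \<in> N"
          using C x Y_iff[OF x(1)] N h m by (auto simp: invariant_subgroup_def)
        thus ?thesis using m x h by (simp add: act_m act_inv)
      qed
      thus ?thesis using x h image_r_coset[OF N h] Y_iff act_closed by simp
    qed
    show "\<phi> \<one>\<^bsub>H\<^esub> ` C = C" if "C \<in> Y" for C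
    proof -
      have "\<phi> \<one>\<^bsub>H\<^esub> ` C = id ` C"
        using Ysub that act_one by (intro image_cong) auto
      thus ?thesis by simp
    qed
    show "\<phi> (h \<otimes>\<^bsub>H\<^esub> h') ` C = \<phi> h ` \<phi> h' ` C"
      if "h \<in> carrier H" "h' \<in> carrier H" "C \<in> Y" for h h' C
      using Ysub that act_mult unfolding image_image by (intro image_cong) auto
    show "finite Y" using YE finE finite_subset by blast
  qed (use p ordH \<open>p dvd card Y\<close> H.is_group in auto)
  have "N #> \<one> = N" by (simp add: G.coset_mult_one N.subset)
  hence "N \<in> Z"
    using Y_iff[of \<one>] invariant_subgroup_image[OF N] by (auto simp: Z_def)
  \<comment> \<open>A singleton has size 1, which is not divisible by \<open>p\<close>.\<close>
  moreover have "Z \<noteq> {N}" using \<open>p dvd card Z\<close> p by auto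
  ultimately obtain C where C: "C \<in> Z" "C \<noteq> N" by blast
  have "C \<in> rcosets N" using C YE by (auto simp: Z_def E_def)
  then obtain x where x: "x \<in> carrier G" "C = N #> x"
    unfolding RCOSETS_def by blast
  have "x \<notin> N" using C x G.coset_join2[OF x(1) sN] by auto
  moreover have "x \<in> fixed_coset_elements N"
  proof -
    have "\<phi> h x \<otimes> inv x \<in> N" if h: "h \<in> carrier H" for h
    proof -
      have "N #> \<phi> h x = N #> x" using C x h image_r_coset[OF N h x(1)] by (auto simp: Z_def)
      thus ?thesis using x h act_closed sN
        by (metis G.coset_join1 G.coset_mult_inv2 G.inv_closed G.m_closed N.subset)
    qed
    moreover have "\<forall>n\<in>N. x \<otimes> n \<otimes> inv x \<in> N" using C x Y_iff by (auto simp: Z_def)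
    ultimately show ?thesis using x by (simp add: fixed_coset_elements_def)
  qed
  ultimately show ?thesis by blast
qed

text \<open>Take \<open>N\<close> maximal among the proper invariant subgroups;
  \<open>{\<one>}\<close> is one of them. The strictly larger invariant subgroup
  \<open>fixed_coset_elements N\<close> must be all of \<open>G\<close>, and its second clause is
  the claim.\<close>

lemma proper_subgroup_containing_commutators:
  assumes p: "Factorial_Ring.prime p" and ordG: "order G = p ^ m" and ordH: "order H = p ^ k"
    and nontriv: "carrier G \<noteq> {\<one>}"
  obtains N where "subgroup N G" "N \<noteq> carrier G"
    "\<And>h x. \<lbrakk>h \<in> carrier H; x \<in> carrier G\<rbrakk> \<Longrightarrow> \<phi> h x \<otimes> inv x \<in> N"
proof -
  have fin: "finite (carrier G)"
    using ordG p by (metis G.order_gt_0_iff_finite prime_gt_0_nat zero_less_power)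
  define M where "M = {N. invariant_subgroup N \<and> N \<noteq> carrier G}"
  have sub: "N \<subseteq> carrier G" if "N \<in> M" for N
    using that subgroup.subset by (auto simp: M_def invariant_subgroup_def)
  have "finite M" using sub fin by (meson Pow_iff finite_Pow_iff finite_subset subsetI)
  moreover have "{\<one>} \<in> M"
    using nontriv G.triv_subgroup by (auto simp: M_def invariant_subgroup_def act_G_one)
  ultimately obtain N where N: "N \<in> M" and max: "\<And>K. \<lbrakk>K \<in> M; N \<subseteq> K\<rbrakk> \<Longrightarrow> N = K"
    using finite_has_maximal[of M] by blast
  have NI: "invariant_subgroup N" "N \<noteq> carrier G" using N by (auto simp: M_def)
  have "fixed_coset_elements N \<notin> M"
    using max fixed_coset_elements_invariant[OF NI(1) fin]
      fixed_coset_elements_greater[OF NI(1) p ordG ordH NI(2)] by blast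
  hence "fixed_coset_elements N = carrier G"
    using fixed_coset_elements_invariant[OF NI(1) fin] by (simp add: M_def)
  hence "\<phi> h x \<otimes> inv x \<in> N" if "h \<in> carrier H" "x \<in> carrier G" for h x
    using that by (auto simp: fixed_coset_elements_def)
  thus thesis using that NI by (auto simp: invariant_subgroup_def)
qed

end

section \<open>The left series of a skew left brace\<close>

context skew_left_brace
begin

text \<open>The rewrites make the group facts about \<open>add_monoid A\<close> available in the
  additive notation of \<open>A\<close>.\<close>

sublocale add: group "add_monoid A"
  rewrites "carrier (add_monoid A) = carrier A"
    and "monoid.mult (add_monoid A) = add A"
    and "monoid.one (add_monoid A) = zero A"
    and "m_inv (add_monoid A) = a_inv A"
  by (rule add_group) (auto simp: a_inv_def)

sublocale circ: group A
  by (rule circ_group)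

section \<open>The action of the circle group on the additive group\<close>

definition lam :: "'a \<Rightarrow> 'a \<Rightarrow> 'a"
  where "lam a b = \<ominus> a \<oplus> a \<otimes> b"

lemma brace_star_eq: "brace_star A a b = lam a b \<oplus> \<ominus> b"
  by (simp add: brace_star_def lam_def a_minus_def)

text \<open>Expand \<open>a \<otimes> (\<zero> \<oplus> \<zero>)\<close> by the brace law and cancel
  \<open>a \<otimes> \<zero>\<close> on the left.\<close>

lemma circ_zero: "a \<in> carrier A \<Longrightarrow> a \<otimes> \<zero> = a"
proof -
  assume a: "a \<in> carrier A"
  have "a \<otimes> \<zero> = a \<otimes> \<zero> \<oplus> (\<ominus> a \<oplus> a \<otimes> \<zero>)"
    using circ_add[of a \<zero> \<zero>] a by (simp add: a_minus_def add.m_assoc)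
  hence "\<ominus> (a \<otimes> \<zero>) \<oplus> a \<otimes> \<zero> = \<ominus> a \<oplus> a \<otimes> \<zero>"
    using a add.inv_mult_cancel_left(1)[of "a \<otimes> \<zero>" "\<ominus> a \<oplus> a \<otimes> \<zero>"] by simp
  hence "a \<oplus> (\<ominus> a \<oplus> a \<otimes> \<zero>) = a" using a by simp
  thus ?thesis using a by (simp add: add.inv_mult_cancel_left)
qed

lemma one_eq_zero: "\<one> = \<zero>"
  using circ_zero[of \<one>] by simp

text \<open>Expand \<open>a \<otimes> (b \<oplus> \<ominus> b)\<close>, which equals
  \<open>a\<close>, by the brace law and solve for the last summand.\<close>

lemma circ_a_inv:
  assumes "a \<in> carrier A" "b \<in> carrier A"
  shows "a \<otimes> (\<ominus> b) = a \<oplus> \<ominus> (a \<otimes> b) \<oplus> a"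
proof -
  have "(a \<otimes> b \<oplus> \<ominus> a) \<oplus> a \<otimes> (\<ominus> b) = a"
    using circ_add[of a b "\<ominus> b"] assms by (simp add: circ_zero a_minus_def)
  hence "a \<otimes> (\<ominus> b) = \<ominus> (a \<otimes> b \<oplus> \<ominus> a) \<oplus> a"
    using assms add.inv_mult_cancel_left(1)[of "a \<otimes> b \<oplus> \<ominus> a" "a \<otimes> (\<ominus> b)"] by simp
  thus ?thesis using assms by (simp add: add.inv_mult_group)
qed

lemma automorphism_action_lam: "automorphism_action (add_monoid A) A lam"
proof
  show "lam a \<in> hom (add_monoid A) (add_monoid A)" if a: "a \<in> carrier A" for a
  proof (rule homI)
    show "lam a (x \<otimes>\<^bsub>add_monoid A\<^esub> y) = lam a x \<otimes>\<^bsub>add_monoid A\<^esub> lam a y"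
      if "x \<in> carrier (add_monoid A)" "y \<in> carrier (add_monoid A)" for x y
      using a that circ_add by (simp add: lam_def a_minus_def add.m_assoc)
  qed (use a in \<open>simp add: lam_def\<close>)
  show "lam \<one> x = x" if "x \<in> carrier (add_monoid A)" for x
    using that circ.l_one[of x] one_eq_zero by (simp add: lam_def)
  show "lam (a \<otimes> b) c = lam a (lam b c)"
    if "a \<in> carrier A" "b \<in> carrier A" "c \<in> carrier (add_monoid A)" for a b c
  proof -
    \<comment> \<open>The brace law is applied to the sum
      \<open>\<ominus> b \<oplus> b \<otimes> c\<close>, and \<open>circ_a_inv\<close> to its first
      summand.\<close>
    have "lam a (lam b c) = \<ominus> a \<oplus> (a \<oplus> \<ominus> (a \<otimes> b) \<oplus> a \<oplus> \<ominus> a \<oplus> a \<otimes> (b \<otimes> c))"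
      using that by (simp add: lam_def circ_add circ_a_inv a_minus_def)
    also have "\<dots> = \<ominus> (a \<otimes> b) \<oplus> a \<otimes> (b \<otimes> c)"
      using that by (simp add: add.m_assoc add.inv_mult_cancel_left)
    finally show ?thesis using that by (simp add: lam_def circ.m_assoc)
  qed
qed

sublocale lam: automorphism_action "add_monoid A" A lam
  rewrites "carrier (add_monoid A) = carrier A"
    and "monoid.mult (add_monoid A) = add A"
    and "monoid.one (add_monoid A) = zero A"
    and "m_inv (add_monoid A) = a_inv A"
  by (rule automorphism_action_lam) (auto simp: a_inv_def)

text \<open>Containment holds since \<open>lam a y\<close> and \<open>y\<close> both lie in
  \<open>S\<close>. For invariance, \<open>lam c\<close> sends the generator \<open>a * y\<close> to
  the generator \<open>d * lam c y\<close>, where \<open>d\<close> is the circle conjugate of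
  \<open>a\<close> by \<open>c\<close>.\<close>

lemma invariant_subgroup_set_star:
  assumes S: "lam.invariant_subgroup S"
  shows "lam.invariant_subgroup (set_star A (carrier A) S)"
    and "set_star A (carrier A) S \<subseteq> S"
proof -
  interpret S: subgroup S "add_monoid A" using S by (simp add: lam.invariant_subgroup_def)
  have Sc: "\<And>x. x \<in> S \<Longrightarrow> x \<in> carrier A" using S.subset by auto
  define X where "X = {brace_star A x y | x y. x \<in> carrier A \<and> y \<in> S}"
  have star: "set_star A (carrier A) S = generate (add_monoid A) X"
    by (simp add: set_star_def X_def)
  have "X \<subseteq> S"
    using S S.m_closed S.m_inv_closed
    by (auto simp: X_def brace_star_eq lam.invariant_subgroup_def a_inv_def)
  thus "set_star A (carrier A) S \<subseteq> S"
    unfolding star by (rule add.generate_subgroup_incl) (rule S.subgroup_axioms)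
  have Xc: "X \<subseteq> carrier A" using \<open>X \<subseteq> S\<close> Sc by auto
  have "lam c x \<in> X" if c: "c \<in> carrier A" and x: "x \<in> X" for c x
  proof -
    obtain a y where ay: "a \<in> carrier A" "y \<in> S" "x = lam a y \<oplus> \<ominus> y"
      using x by (auto simp: X_def brace_star_eq)
    \<comment> \<open>Chosen so that \<open>?d \<otimes> c = c \<otimes> a\<close>, which moves
      \<open>lam c\<close> past \<open>lam a\<close>.\<close>
    let ?d = "c \<otimes> a \<otimes> inv c"
    have "lam ?d (lam c y) = lam (?d \<otimes> c) y"
      using c ay Sc by (subst lam.act_mult) auto
    also have "?d \<otimes> c = c \<otimes> a" using c ay by (simp add: circ.m_assoc)
    also have "lam (c \<otimes> a) y = lam c (lam a y)"
      using c ay Sc lam.act_mult by simp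
    finally have "lam c x = lam ?d (lam c y) \<oplus> \<ominus> (lam c y)"
      using c ay Sc by (simp add: lam.act_m lam.act_inv lam.act_closed)
    moreover have "lam c y \<in> S" using S c ay by (simp add: lam.invariant_subgroup_def)
    moreover have "?d \<in> carrier A" using c ay by simp
    ultimately show ?thesis unfolding X_def brace_star_eq by blast
  qed
  hence "lam c x \<in> generate (add_monoid A) X"
    if c: "c \<in> carrier A" and x: "x \<in> generate (add_monoid A) X" for c x
  proof -
    have "lam c ` generate (add_monoid A) X = generate (add_monoid A) (lam c ` X)"
      using group_hom.generate_img[OF lam.act_group_hom[OF c]] Xc by simp
    also have "\<dots> \<subseteq> generate (add_monoid A) X"
      using \<open>\<And>x c. \<lbrakk>c \<in> carrier A; x \<in> X\<rbrakk> \<Longrightarrow> lam c x \<in> X\<close> c by (intro add.mono_generate) auto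
    finally show ?thesis using x by blast
  qed
  thus "lam.invariant_subgroup (set_star A (carrier A) S)"
    using add.generate_is_subgroup[OF Xc] by (simp add: lam.invariant_subgroup_def star)
qed

text \<open>By Lagrange \<open>S\<close> is again of \<open>p\<close>-power order, and the star
  products \<open>lam h x \<oplus> \<ominus> x\<close> are exactly the commutators that a proper
  subgroup of \<open>S\<close> contains.\<close>

lemma set_star_proper:
  assumes p: "Factorial_Ring.prime p" and ord: "order A = p ^ m"
    and S: "lam.invariant_subgroup S" and nontriv: "S \<noteq> {\<zero>}"
  shows "set_star A (carrier A) S \<subset> S"
proof -
  let ?S = "add_monoid A\<lparr>carrier := S\<rparr>"
  have sS: "subgroup S (add_monoid A)" using S by (simp add: lam.invariant_subgroup_def)
  interpret S: automorphism_action ?S A lam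
    by (rule lam.automorphism_action_subgroup[OF S])
  have "card S dvd p ^ m"
    using add.lagrange[OF sS] ord by (metis dvd_triv_right order_def partial_object.select_convs(1)
        monoid.simps(1))
  then obtain j where "order ?S = p ^ j"
    using p by (auto simp: order_def divides_primepow_nat)
  moreover have "carrier ?S \<noteq> {\<one>\<^bsub>?S\<^esub>}" using nontriv by simp
  ultimately obtain N where N: "subgroup N ?S" "N \<noteq> carrier ?S"
    "\<And>h x. \<lbrakk>h \<in> carrier A; x \<in> carrier ?S\<rbrakk> \<Longrightarrow> lam h x \<otimes>\<^bsub>?S\<^esub> inv\<^bsub>?S\<^esub> x \<in> N"
    using S.proper_subgroup_containing_commutators[OF p _ ord] by blast
  have "brace_star A h x \<in> N" if "h \<in> carrier A" "x \<in> S" for h x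
    using N(3)[of h x] that add.m_inv_consistent[OF sS] by (simp add: brace_star_eq)
  hence "set_star A (carrier A) S \<subseteq> N"
    unfolding set_star_def
    by (intro add.generate_subgroup_incl) (use add.incl_subgroup[OF sS N(1)] in auto)
  moreover have "N \<subset> S" using N subgroup.subset[OF N(1)] by auto
  ultimately show ?thesis by blast
qed

lemma left_nilpotent_prime_power:
  assumes p: "Factorial_Ring.prime p" and ord: "order A = p ^ m"
  shows "left_nilpotent A"
proof (rule ccontr)
  assume "\<not> left_nilpotent A"
  \<comment> \<open>Indexing by \<open>Suc n\<close> covers all \<open>k \<ge> 1\<close> and avoids
    the dummy term at 0.\<close>
  hence nontriv: "left_series A (Suc n) \<noteq> {\<zero>}" for n
    by (auto simp: left_nilpotent_def)
  have inv: "lam.invariant_subgroup (left_series A (Suc n))" for n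
  proof (induction n)
    case 0
    show ?case using add.subgroup_self lam.act_closed by (simp add: lam.invariant_subgroup_def)
  qed (simp add: invariant_subgroup_set_star)
  have sub: "subgroup (left_series A (Suc n)) (add_monoid A)" for n
    using inv[of n] by (simp add: lam.invariant_subgroup_def)
  have sub_carrier: "left_series A (Suc n) \<subseteq> carrier A" for n
    using subgroup.subset[OF sub[of n]] by simp
  have fin: "finite (carrier A)"
    using ord p by (metis circ.order_gt_0_iff_finite prime_gt_0_nat zero_less_power)
  \<comment> \<open>Each step of the series loses at least one element. At
    \<open>n = card (carrier A)\<close> nothing would be left, yet a subgroup contains
    \<zero>.\<close>
  have bound: "card (left_series A (Suc n)) + n \<le> card (carrier A)" for n
  proof (induction n)
    case (Suc n)
    have "card (left_series A (Suc (Suc n))) < card (left_series A (Suc n))"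
      using set_star_proper[OF p ord inv nontriv] finite_subset[OF sub_carrier fin]
      by (simp add: psubset_card_mono)
    thus ?case using Suc by linarith
  qed simp
  have "left_series A (Suc n) \<noteq> {}" for n
    using subgroup.one_closed[OF sub[of n]] by blast
  moreover have "finite (left_series A (Suc n))" for n
    using sub_carrier fin by (rule finite_subset)
  ultimately have "card (left_series A (Suc (card (carrier A)))) > 0"
    by (simp add: card_gt_0_iff)
  with bound[of "card (carrier A)"] show False by linarith
qed

end

theorem proposition4p4:
  fixes A :: "('a, 'b) ring_scheme" and p m :: nat
  assumes "Factorial_Ring.prime p"
    and "skew_left_brace A"
    and "order A = p ^ m"
  shows "left_nilpotent A"
  using skew_left_brace.left_nilpotent_prime_power assms by blast

end
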